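(* Let $X$ (treatment) and $Y$ (response) be random variables, let $x,x'$ be given values of $X$, and let $\mathbf{T}_1,\mathbf{T}_2$ be two sets of random variables. Suppose $\mathbf{U}$ is a Markov boundary of $Y$ relative to $\mathbf{T}_1\cup\mathbf{T}_2\cup\{X\}$ satisfying $$X\perp\!\!\!\perp\bigl((\mathbf{U}\setminus\{X\})\cap(\mathbf{T}_{3-i}\setminus\mathbf{T}_i)\bigr)\mid\mathbf{T}_i\qquad\text{for } i=1,2.$$ Then $\mathbf{T}_1$ and $\mathbf{T}_2$ are weakly equivalent to each other (given $x$ and $x'$, relative to $(X,Y)$), i.e. for every value $y$ of $Y$, $$\sum_{\mathbf{t}_1}\operatorname{pr}(y\mid x,\mathbf{t}_1)\operatorname{pr}(\mathbf{t}_1\mid x')=\sum_{\mathbf{t}_2}\operatorname{pr}(y\mid x,\mathbf{t}_2)\operatorname{pr}(\mathbf{t}_2\mid x').$$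
   Context: All random variables $X$, $Y$ and those in $\mathbf{T}_1\cup\mathbf{T}_2$ are defined on a common probability space; $X,Y\notin \mathbf{T}_1\cup\mathbf{T}_2$. The variables are discrete (for continuous variables, sums are replaced by integrals). $\operatorname{pr}(\cdot)$ and $\operatorname{pr}(\cdot\mid\cdot)$ denote marginal and conditional probabilities, e.g. $\operatorname{pr}(y\mid x,\mathbf{t})=\operatorname{pr}(Y=y\mid X=x,\mathbf{T}=\mathbf{t})$. $\mathbf{A}\perp\!\!\!\perp\mathbf{B}\mid\mathbf{C}$ means $\mathbf{A}$ is conditionally independent of $\mathbf{B}$ given $\mathbf{C}$ (trivially true if $\mathbf{A}$ or $\mathbf{B}$ is empty; conditioning on the empty set means unconditional independence). Markov blanket/boundary: for a random variable $A$ and a set $\mathbf{V}$ of random variables, a subset $\mathbf{V}^m\subset\mathbf{V}$ is a Markov blanket of $A$ relative to $\mathbf{V}$ if $A\perp\!\!\!\perp(\mathbf{V}\setminus\mathbf{V}^m)\mid\mathbf{V}^m$; a minimal Markov blanket (with respect to inclusion) is called a Markov boundary of $A$ relative to $\mathbf{V}$. Definition (weak equivalence, i.e. equivalence given $x$ and $x'$ relative to $(X,Y)$): $\mathbf{T}_1$ and $\mathbf{T}_2$ are weakly equivalent if, for every $y$, $\sum_{\mathbf{t}_1}\operatorname{pr}(y|x,\mathbf{t}_1)\operatorname{pr}(\mathbf{t}_1|x')=\sum_{\mathbf{t}_2}\operatorname{pr}(y|x,\mathbf{t}_2)\operatorname{pr}(\mathbf{t}_2|x')$, where the left-hand (respectively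 right-hand) side is replaced by $\operatorname{pr}(y|x)$ when $\mathbf{T}_1$ (respectively $\mathbf{T}_2$) is empty. Well-definedness: $\operatorname{pr}(x)>0$, $\operatorname{pr}(x')>0$, and for $i=1,2$, $\operatorname{pr}(x,\mathbf{t}_i)>0$ for every value $\mathbf{t}_i$ with $\operatorname{pr}(x',\mathbf{t}_i)>0$; the sums range over values $\mathbf{t}_i$ with $\operatorname{pr}(\mathbf{t}_i\mid x')>0$. *)

theory Defs
  imports "HOL-Probability.Probability"
begin

text \<open>
  Random variables form a family \<open>Z\<close> over an index type, and sets of random variables are sets of
  indices. A single value type suffices: all variables are discrete, so differing value spaces
  embed into a common one.
\<close>

definition discrete_rv :: "'a measure \<Rightarrow> ('a \<Rightarrow> 'v) \<Rightarrow> bool" where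
  "discrete_rv M V \<longleftrightarrow> V \<in> measurable M (count_space UNIV) \<and> countable (V ` space M)"

text \<open>The event that the variables in \<open>S\<close> take the values \<open>s\<close>; it is the sure event for \<open>S = {}\<close>.\<close>

definition takes :: "('i \<Rightarrow> 'a \<Rightarrow> 'v) \<Rightarrow> 'i set \<Rightarrow> ('i \<Rightarrow> 'v) \<Rightarrow> 'a \<Rightarrow> bool" where
  "takes Z S s \<omega> \<longleftrightarrow> (\<forall>i\<in>S. Z i \<omega> = s i)"

text \<open>
  Conditional independence of discrete random vectors, for finite index sets. For \<open>C = {}\<close> this is
  unconditional independence.
\<close>

definition cond_indep ::
  "'a measure \<Rightarrow> ('i \<Rightarrow> 'a \<Rightarrow> 'v) \<Rightarrow> 'i set \<Rightarrow> 'i set \<Rightarrow> 'i set \<Rightarrow> bool" where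
  "cond_indep M Z A B C \<longleftrightarrow>
     (\<forall>a b c. \<P>(\<omega> in M. takes Z C c \<omega>) > 0 \<longrightarrow>
        \<P>(\<omega> in M. takes Z A a \<omega> \<and> takes Z B b \<omega> \<bar> takes Z C c \<omega>) =
        \<P>(\<omega> in M. takes Z A a \<omega> \<bar> takes Z C c \<omega>) * \<P>(\<omega> in M. takes Z B b \<omega> \<bar> takes Z C c \<omega>))"

definition markov_blanket ::
  "'a measure \<Rightarrow> ('i \<Rightarrow> 'a \<Rightarrow> 'v) \<Rightarrow> 'i \<Rightarrow> 'i set \<Rightarrow> 'i set \<Rightarrow> bool" where
  "markov_blanket M Z A V W \<longleftrightarrow> W \<subseteq> V \<and> cond_indep M Z {A} (V - W) W"

definition markov_boundary ::
  "'a measure \<Rightarrow> ('i \<Rightarrow> 'a \<Rightarrow> 'v) \<Rightarrow> 'i \<Rightarrow> 'i set \<Rightarrow> 'i set \<Rightarrow> bool" where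
  "markov_boundary M Z A V W \<longleftrightarrow>
     markov_blanket M Z A V W \<and> (\<forall>W'. W' \<subset> W \<longrightarrow> \<not> markov_blanket M Z A V W')"

text \<open>
  Value vectors are extensional functions on \<open>T\<close>, so each vector is summed over exactly once.
  For discrete variables and finite \<open>T\<close> the sum always converges: its terms lie between 0 and
  \<open>pr(t | x')\<close>.
\<close>

definition adjusted_prob ::
  "'a measure \<Rightarrow> ('i \<Rightarrow> 'a \<Rightarrow> 'v) \<Rightarrow> 'i \<Rightarrow> 'i \<Rightarrow> 'v \<Rightarrow> 'v \<Rightarrow> 'i set \<Rightarrow> 'v \<Rightarrow> real" where
  "adjusted_prob M Z X Y x x' T y =
     (if T = {} then \<P>(\<omega> in M. Z Y \<omega> = y \<bar> Z X \<omega> = x)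
      else (\<Sum>\<^sub>\<infinity>t \<in> {t \<in> T \<rightarrow>\<^sub>E UNIV. \<P>(\<omega> in M. takes Z T t \<omega> \<bar> Z X \<omega> = x') > 0}.
              \<P>(\<omega> in M. Z Y \<omega> = y \<bar> Z X \<omega> = x \<and> takes Z T t \<omega>) *
              \<P>(\<omega> in M. takes Z T t \<omega> \<bar> Z X \<omega> = x')))"

definition weakly_equivalent ::
  "'a measure \<Rightarrow> ('i \<Rightarrow> 'a \<Rightarrow> 'v) \<Rightarrow> 'i \<Rightarrow> 'i \<Rightarrow> 'v \<Rightarrow> 'v \<Rightarrow> 'i set \<Rightarrow> 'i set \<Rightarrow> bool" where
  "weakly_equivalent M Z X Y x x' T\<^sub>1 T\<^sub>2 \<longleftrightarrow>
     (\<forall>y. adjusted_prob M Z X Y x x' T\<^sub>1 y = adjusted_prob M Z X Y x x' T\<^sub>2 y)"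

end

theory Submission
  imports Defs
begin

text \<open>
  By the Markov property, \<open>pr(y | x, s) = q s\<close> for every set \<open>S\<close> of covariates containing
  \<open>U - {X}\<close>, where \<open>q\<close> depends only on the coordinates in \<open>U - {X}\<close>. For \<open>T = T\<^sub>i\<close> put
  \<open>S = T \<union> (U - {X})\<close>. Since \<open>X\<close> is independent of \<open>S - T\<close> given \<open>T\<close>,
  the expectation of \<open>q Z\<close> given \<open>T = t\<close> does not change on conditioning further on \<open>X = x\<close>, which
  yields \<open>pr(y | x, t)\<close>, or on \<open>X = x'\<close>. Hence the adjustment sum over \<open>T\<close> is the expectation
  of \<open>q Z\<close> given \<open>X = x'\<close>, which does not depend on \<open>T\<close>.
\<close>

section \<open>Splitting an integral over the fibres of a discrete map\<close>

text \<open>Numbering the countable range by \<open>to_nat_on\<close> turns the fibres into a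
  sequence, for which sum and integral may be exchanged by absolute convergence. The superset
  \<open>C\<close> of the range lets later sums run over all value vectors, attained or not.\<close>

lemma has_sum_integral_fibres:
  fixes g :: "'a \<Rightarrow> real"
  assumes g: "integrable M g" and V: "V \<in> measurable M (count_space UNIV)"
    and C: "countable (V ` space M)" "V ` space M \<subseteq> C"
  shows "((\<lambda>v. \<integral>\<omega>. g \<omega> * of_bool (V \<omega> = v) \<partial>M) has_sum (\<integral>\<omega>. g \<omega> \<partial>M)) C"
proof -
  define e where "e = to_nat_on (V ` space M)"
  define h where "h n \<omega> = g \<omega> * of_bool (e (V \<omega>) = n)" for n \<omega>
  have e: "inj_on e (V ` space M)"
    unfolding e_def using C(1) by (rule inj_on_to_nat_on)
  have [measurable]: "V \<in> measurable M (count_space UNIV)" "g \<in> borel_measurable M"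
    using V g by auto
  have [measurable]: "h n \<in> borel_measurable M" for n
    unfolding h_def by measurable
  have int: "integrable M (h n)" for n
    by (rule Bochner_Integration.integrable_bound[OF g]) (auto simp: h_def)
  have int_norm: "integrable M (\<lambda>\<omega>. norm (h n \<omega>))" for n
    using int by simp
  \<comment> \<open>The fibres are disjoint, so at most one summand is nonzero. This bound yields
    summability both at each point and of the integrated norms.\<close>
  have bound: "(\<Sum>i<n. norm (h i \<omega>)) \<le> norm (g \<omega>)" for n \<omega>
  proof -
    have "(\<Sum>i<n. norm (h i \<omega>)) = (\<Sum>i<n. if e (V \<omega>) = i then norm (g \<omega>) else 0)"
      by (rule sum.cong) (auto simp: h_def)
    also have "\<dots> \<le> norm (g \<omega>)"
      by (subst sum.delta') auto
    finally show ?thesis .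
  qed
  have sums: "(\<lambda>n. h n \<omega>) sums g \<omega>" for \<omega>
    using sums_single[of "e (V \<omega>)" "\<lambda>_. g \<omega>"]
    by (rule sums_cong[THEN iffD1, rotated]) (auto simp: h_def)
  have summ: "summable (\<lambda>n. \<integral>\<omega>. norm (h n \<omega>) \<partial>M)"
  proof (rule summableI_nonneg_bounded)
    fix n
    have "(\<Sum>i<n. \<integral>\<omega>. norm (h i \<omega>) \<partial>M) = (\<integral>\<omega>. (\<Sum>i<n. norm (h i \<omega>)) \<partial>M)"
      using int_norm by (subst Bochner_Integration.integral_sum) auto
    also have "\<dots> \<le> (\<integral>\<omega>. norm (g \<omega>) \<partial>M)"
      using int_norm g bound by (intro integral_mono) auto
    finally show "(\<Sum>i<n. \<integral>\<omega>. norm (h i \<omega>) \<partial>M) \<le> (\<integral>\<omega>. norm (g \<omega>) \<partial>M)" .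
  qed simp
  have ptw: "AE \<omega> in M. summable (\<lambda>n. norm (h n \<omega>))"
    using bound by (intro AE_I2 summableI_nonneg_bounded[where x = "norm (g _)"]) auto
  have "(\<lambda>n. \<integral>\<omega>. h n \<omega> \<partial>M) sums (\<integral>\<omega>. (\<Sum>n. h n \<omega>) \<partial>M)"
    using int ptw summ by (rule sums_integral)
  then have "(\<lambda>n. \<integral>\<omega>. h n \<omega> \<partial>M) sums (\<integral>\<omega>. g \<omega> \<partial>M)"
    by (simp add: sums_unique[OF sums, symmetric])
  \<comment> \<open>Absolute summability turns convergence in the chosen order into unordered
    summation.\<close>
  moreover have "summable (\<lambda>n. norm (\<integral>\<omega>. h n \<omega> \<partial>M))"
    by (rule summable_comparison_test'[OF summ, of 0]) (auto intro: integral_norm_bound)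
  ultimately have "((\<lambda>n. \<integral>\<omega>. h n \<omega> \<partial>M) has_sum (\<integral>\<omega>. g \<omega> \<partial>M)) UNIV"
    by (intro norm_summable_imp_has_sum)
  also have "?this \<longleftrightarrow> ((\<lambda>n. \<integral>\<omega>. h n \<omega> \<partial>M) has_sum (\<integral>\<omega>. g \<omega> \<partial>M)) (e ` V ` space M)"
  proof (rule has_sum_cong_neutral)
    fix n assume "n \<in> UNIV - e ` V ` space M"
    then show "(\<integral>\<omega>. h n \<omega> \<partial>M) = 0"
      by (intro integral_eq_zero_AE AE_I2) (auto simp: h_def)
  qed auto
  also have "\<dots> \<longleftrightarrow> ((\<lambda>v. \<integral>\<omega>. h (e v) \<omega> \<partial>M) has_sum (\<integral>\<omega>. g \<omega> \<partial>M)) (V ` space M)"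
    by (subst has_sum_reindex[OF e]) (simp add: o_def)
  also have "\<dots> \<longleftrightarrow> ?thesis"
  proof (rule has_sum_cong_neutral)
    \<comment> \<open>Values in \<open>C\<close> that \<open>V\<close> never takes have empty
      fibres, so passing to a possibly uncountable \<open>C\<close> only adds zeros.\<close>
    fix v assume "v \<in> C - V ` space M"
    then show "(\<integral>\<omega>. g \<omega> * of_bool (V \<omega> = v) \<partial>M) = 0"
      by (intro integral_eq_zero_AE AE_I2) auto
  next
    fix v assume "v \<in> V ` space M \<inter> C"
    then show "(\<integral>\<omega>. h (e v) \<omega> \<partial>M) = (\<integral>\<omega>. g \<omega> * of_bool (V \<omega> = v) \<partial>M)"
      using e by (intro Bochner_Integration.integral_cong) (auto simp: h_def inj_on_eq_iff)
  qed (use C(2) in auto)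
  finally show ?thesis .
qed

section \<open>Events fixing the values of several variables\<close>

lemma takes_Un: "takes Z (S \<union> T) s \<omega> \<longleftrightarrow> takes Z S s \<omega> \<and> takes Z T s \<omega>"
  by (auto simp: takes_def)

lemma takes_cong: "(\<And>i. i \<in> S \<Longrightarrow> s i = t i) \<Longrightarrow> takes Z S s \<omega> \<longleftrightarrow> takes Z S t \<omega>"
  by (auto simp: takes_def)

lemma takes_merge:
  "S \<inter> T = {} \<Longrightarrow>
    takes Z S s \<omega> \<and> takes Z T t \<omega> \<longleftrightarrow> takes Z (S \<union> T) (\<lambda>i. if i \<in> S then s i else t i) \<omega>"
  by (auto simp: takes_def)

text \<open>Links these events to the fibres of a single random vector. Extensionality of
  \<open>s\<close> matters because the restricted vector is \<open>undefined\<close> outside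
  \<open>S\<close>.\<close>

lemma takes_iff_restrict:
  "s \<in> S \<rightarrow>\<^sub>E UNIV \<Longrightarrow> takes Z S s \<omega> \<longleftrightarrow> (\<lambda>i\<in>S. Z i \<omega>) = s"
  by (auto simp: takes_def fun_eq_iff PiE_def extensional_def)

section \<open>Measurability and total probability for a discrete family\<close>

locale discrete_family = prob_space M for M :: "'a measure" +
  fixes Z :: "'i \<Rightarrow> 'a \<Rightarrow> 'v" and I :: "'i set"
  assumes discrete: "i \<in> I \<Longrightarrow> discrete_rv M (Z i)"
begin

lemma measurable_component: "i \<in> I \<Longrightarrow> Z i \<in> measurable M (count_space UNIV)"
  using discrete by (auto simp: discrete_rv_def)

lemma pred_eq_component: "i \<in> I \<Longrightarrow> Measurable.pred M (\<lambda>\<omega>. Z i \<omega> = c)"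
  using measurable_component[of i] by measurable

lemma pred_takes: "finite S \<Longrightarrow> S \<subseteq> I \<Longrightarrow> Measurable.pred M (takes Z S s)"
  unfolding takes_def
  by (rule pred_intros_finite) (auto intro: pred_eq_component)

lemma countable_range_restrict:
  assumes "finite S" "S \<subseteq> I"
  shows "countable ((\<lambda>\<omega>. \<lambda>i\<in>S. Z i \<omega>) ` space M)"
proof (rule countable_subset)
  show "(\<lambda>\<omega>. \<lambda>i\<in>S. Z i \<omega>) ` space M \<subseteq> (\<Pi>\<^sub>E i\<in>S. Z i ` space M)"
    by auto
  show "countable (\<Pi>\<^sub>E i\<in>S. Z i ` space M)"
    using assms discrete by (intro countable_PiE) (auto simp: discrete_rv_def)
qed

text \<open>Since the range is countable, it suffices to check preimages of points, and these are
  \<open>takes\<close> events.\<close>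

lemma measurable_restrict_family:
  assumes S: "finite S" "S \<subseteq> I"
  shows "(\<lambda>\<omega>. \<lambda>i\<in>S. Z i \<omega>) \<in> measurable M (count_space UNIV)"
proof -
  let ?V = "\<lambda>\<omega>. \<lambda>i\<in>S. Z i \<omega>"
  have "?V -` {s} \<inter> space M \<in> sets M" if "s \<in> ?V ` space M" for s
  proof -
    have "s \<in> S \<rightarrow>\<^sub>E UNIV"
      using that by auto
    then have "?V -` {s} \<inter> space M = {\<omega> \<in> space M. takes Z S s \<omega>}"
      by (auto simp: takes_iff_restrict)
    then show ?thesis
      using pred_takes[OF S] by (simp add: pred_def)
  qed
  then have "?V \<in> measurable M (count_space (?V ` space M))"
    using countable_range_restrict[OF S] by (subst measurable_count_space_eq_countable) auto
  then show ?thesis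
    by (rule measurable_compose) simp
qed

text \<open>Law of total expectation, obtained from the fibres of the joint vector of the variables
  in \<open>S\<close>.\<close>

lemma has_sum_integral_takes:
  fixes g :: "'a \<Rightarrow> real"
  assumes "integrable M g" "finite S" "S \<subseteq> I"
  shows "((\<lambda>s. \<integral>\<omega>. g \<omega> * of_bool (takes Z S s \<omega>) \<partial>M) has_sum (\<integral>\<omega>. g \<omega> \<partial>M)) (S \<rightarrow>\<^sub>E UNIV)"
proof -
  have "((\<lambda>s. \<integral>\<omega>. g \<omega> * of_bool ((\<lambda>i\<in>S. Z i \<omega>) = s) \<partial>M) has_sum (\<integral>\<omega>. g \<omega> \<partial>M)) (S \<rightarrow>\<^sub>E UNIV)"
    using assms
    by (intro has_sum_integral_fibres measurable_restrict_family countable_range_restrict) auto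
  also have "?this \<longleftrightarrow> ?thesis"
    by (intro has_sum_cong) (simp add: takes_iff_restrict)
  finally show ?thesis .
qed

lemma prob_eq_integral: "\<P>(\<omega> in M. P \<omega>) = (\<integral>\<omega>. of_bool (P \<omega>) \<partial>M)" if "Measurable.pred M P"
proof -
  have "(\<integral>\<omega>. of_bool (P \<omega>) \<partial>M) = (\<integral>\<omega>. indicator {\<omega> \<in> space M. P \<omega>} \<omega> \<partial>M :: real)"
    by (rule Bochner_Integration.integral_cong) (auto simp: indicator_def)
  then show ?thesis
    by (simp add: Int_absorb2 Collect_subset)
qed

lemma integrable_of_bool: "Measurable.pred M P \<Longrightarrow> integrable M (\<lambda>\<omega>. of_bool (P \<omega>) :: real)"
  by (rule integrable_const_bound[where B = 1]) auto

text \<open>Law of total probability: the case where \<open>g\<close> is the indicator of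
  \<open>P\<close>.\<close>

lemma has_sum_prob_takes:
  assumes P: "Measurable.pred M P" and S: "finite S" "S \<subseteq> I"
  shows "((\<lambda>s. \<P>(\<omega> in M. P \<omega> \<and> takes Z S s \<omega>)) has_sum \<P>(\<omega> in M. P \<omega>)) (S \<rightarrow>\<^sub>E UNIV)"
proof -
  have [measurable]: "Measurable.pred M (takes Z S s)" for s
    using S by (rule pred_takes)
  note P[measurable]
  show ?thesis
    using has_sum_integral_takes[OF integrable_of_bool[OF P] S]
    by (simp add: prob_eq_integral of_bool_conj)
qed

section \<open>Conditional independence in product form\<close>

text \<open>Clearing denominators removes the positivity guard, since for a null conditioning event
  both products vanish by monotonicity. The product form can then be summed term by term.\<close>

lemma cond_indep_iff_mult:
  assumes C: "finite C" "C \<subseteq> I"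
  shows "cond_indep M Z A B C \<longleftrightarrow>
    (\<forall>a b c. \<P>(\<omega> in M. (takes Z A a \<omega> \<and> takes Z B b \<omega>) \<and> takes Z C c \<omega>) * \<P>(\<omega> in M. takes Z C c \<omega>) =
      \<P>(\<omega> in M. takes Z A a \<omega> \<and> takes Z C c \<omega>) * \<P>(\<omega> in M. takes Z B b \<omega> \<and> takes Z C c \<omega>))"
proof -
  have null: "\<P>(\<omega> in M. P \<omega> \<and> takes Z C c \<omega>) = 0" if "\<not> \<P>(\<omega> in M. takes Z C c \<omega>) > 0" for P c
  proof -
    have "\<P>(\<omega> in M. P \<omega> \<and> takes Z C c \<omega>) \<le> \<P>(\<omega> in M. takes Z C c \<omega>)"
      using pred_takes[OF C] by (intro finite_measure_mono) (auto simp: pred_def)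
    then show ?thesis
      using that measure_nonneg[of M] by (meson antisym linorder_not_less order_trans)
  qed
  have "(\<P>(\<omega> in M. takes Z C c \<omega>) > 0 \<longrightarrow>
        \<P>(\<omega> in M. takes Z A a \<omega> \<and> takes Z B b \<omega> \<bar> takes Z C c \<omega>) =
        \<P>(\<omega> in M. takes Z A a \<omega> \<bar> takes Z C c \<omega>) * \<P>(\<omega> in M. takes Z B b \<omega> \<bar> takes Z C c \<omega>)) \<longleftrightarrow>
      \<P>(\<omega> in M. (takes Z A a \<omega> \<and> takes Z B b \<omega>) \<and> takes Z C c \<omega>) * \<P>(\<omega> in M. takes Z C c \<omega>) =
      \<P>(\<omega> in M. takes Z A a \<omega> \<and> takes Z C c \<omega>) * \<P>(\<omega> in M. takes Z B b \<omega> \<and> takes Z C c \<omega>)" for a b c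
    using null[of c "\<lambda>_. True"] null[of c]
    by (cases "\<P>(\<omega> in M. takes Z C c \<omega>) > 0") (auto simp: cond_prob_def field_simps)
  then show ?thesis
    unfolding cond_indep_def by simp
qed

text \<open>Decomposition property: the product form is linear in the probabilities involving
  \<open>B\<close>, so it survives summation over the values of \<open>B - B'\<close>.\<close>

lemma cond_indep_subset:
  assumes ci: "cond_indep M Z A B C" and sub: "B' \<subseteq> B"
    and fin: "finite A" "finite B" "finite C" and I: "A \<subseteq> I" "B \<subseteq> I" "C \<subseteq> I"
  shows "cond_indep M Z A B' C"
  unfolding cond_indep_iff_mult[OF fin(3) I(3)]
proof (intro allI)
  fix a b c :: "'i \<Rightarrow> 'v"
  \<comment> \<open>Joins the fixed values \<open>b\<close> on \<open>B'\<close> with the summation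
    variable \<open>s\<close> on \<open>B - B'\<close>.\<close>
  let ?m = "\<lambda>s i. if i \<in> B' then b i else s i"
  have B: "finite B'" "B' \<subseteq> I" "finite (B - B')" "B - B' \<subseteq> I"
    using sub fin I by (auto intro: finite_subset)
  have [measurable]: "Measurable.pred M (takes Z A s)" "Measurable.pred M (takes Z B' s)"
      "Measurable.pred M (takes Z C s)" for s
    using fin I B by (auto intro: pred_takes)
  have m: "takes Z B' b \<omega> \<and> takes Z (B - B') s \<omega> \<longleftrightarrow> takes Z B (?m s) \<omega>" for s \<omega>
    using takes_merge[of B' "B - B'" Z b \<omega> s] sub by (simp add: Un_absorb1)
  have 1: "((\<lambda>s. \<P>(\<omega> in M. (takes Z A a \<omega> \<and> takes Z B (?m s) \<omega>) \<and> takes Z C c \<omega>))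
      has_sum \<P>(\<omega> in M. (takes Z A a \<omega> \<and> takes Z B' b \<omega>) \<and> takes Z C c \<omega>)) ((B - B') \<rightarrow>\<^sub>E UNIV)"
    unfolding m[symmetric]
    using has_sum_prob_takes[of "\<lambda>\<omega>. (takes Z A a \<omega> \<and> takes Z B' b \<omega>) \<and> takes Z C c \<omega>", OF _ B(3,4)]
    by (simp add: conj_ac)
  have 2: "((\<lambda>s. \<P>(\<omega> in M. takes Z B (?m s) \<omega> \<and> takes Z C c \<omega>))
      has_sum \<P>(\<omega> in M. takes Z B' b \<omega> \<and> takes Z C c \<omega>)) ((B - B') \<rightarrow>\<^sub>E UNIV)"
    unfolding m[symmetric]
    using has_sum_prob_takes[of "\<lambda>\<omega>. takes Z B' b \<omega> \<and> takes Z C c \<omega>", OF _ B(3,4)]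
    by (simp add: conj_ac)
  show "\<P>(\<omega> in M. (takes Z A a \<omega> \<and> takes Z B' b \<omega>) \<and> takes Z C c \<omega>) * \<P>(\<omega> in M. takes Z C c \<omega>) =
      \<P>(\<omega> in M. takes Z A a \<omega> \<and> takes Z C c \<omega>) * \<P>(\<omega> in M. takes Z B' b \<omega> \<and> takes Z C c \<omega>)"
    by (rule has_sum_unique[OF has_sum_cmult_left[OF 1]])
      (use has_sum_cmult_right[OF 2] ci in \<open>simp only: cond_indep_iff_mult[OF fin(3) I(3)]\<close>)
qed

section \<open>The adjustment sum as an expectation\<close>

text \<open>\<open>W\<close> stands for the blanket covariates missing from \<open>T\<close>, and
  \<open>q\<close> for the probability of \<open>y\<close> given \<open>x\<close> and the blanket.
  The resulting expectation mentions neither \<open>T\<close> nor \<open>W\<close>, so adjustment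
  sets sharing one \<open>q\<close> share one value.\<close>

lemma adjusted_prob_eq_expectation:
  fixes q :: "('i \<Rightarrow> 'v) \<Rightarrow> real"
  assumes T: "finite T" "T \<subseteq> I" and W: "finite W" "W \<subseteq> I" and TW: "T \<inter> W = {}"
    and XY: "X \<in> I" "Y \<in> I"
    and q: "\<And>s. \<bar>q s\<bar> \<le> 1" "\<And>s t. (\<And>i. i \<in> T \<union> W \<Longrightarrow> s i = t i) \<Longrightarrow> q s = q t"
    and y: "\<And>s. \<P>(\<omega> in M. Z Y \<omega> = y \<and> Z X \<omega> = x \<and> takes Z (T \<union> W) s \<omega>) =
        q s * \<P>(\<omega> in M. Z X \<omega> = x \<and> takes Z (T \<union> W) s \<omega>)"
    and ci: "cond_indep M Z {X} W T"
    and x': "\<P>(\<omega> in M. Z X \<omega> = x') > 0"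
    and pos: "\<And>t. \<P>(\<omega> in M. Z X \<omega> = x' \<and> takes Z T t \<omega>) > 0 \<Longrightarrow>
        \<P>(\<omega> in M. Z X \<omega> = x \<and> takes Z T t \<omega>) > 0"
  shows "adjusted_prob M Z X Y x x' T y =
    (\<integral>\<omega>. q (\<lambda>i. Z i \<omega>) * of_bool (Z X \<omega> = x') \<partial>M) / \<P>(\<omega> in M. Z X \<omega> = x')"
proof -
  define g where "g \<omega> = q (\<lambda>i. Z i \<omega>)" for \<omega>
  define m where "m t w i = (if i \<in> T then t i else w i)" for t w :: "'i \<Rightarrow> 'v" and i
  \<comment> \<open>The unnormalised expectation of \<open>g\<close> on the stratum
    \<open>X = z\<close>, \<open>T = t\<close>. Avoiding division keeps it additive and meaningful
    on null strata.\<close>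
  define G where "G z t = (\<integral>\<omega>. g \<omega> * of_bool (Z X \<omega> = z \<and> takes Z T t \<omega>) \<partial>M)" for z t
  have S: "finite (T \<union> W)" "T \<union> W \<subseteq> I"
    using T W by auto
  have [measurable]: "Measurable.pred M (takes Z T s)" "Measurable.pred M (takes Z W s)"
      "Measurable.pred M (takes Z (T \<union> W) s)" "Measurable.pred M (\<lambda>\<omega>. Z X \<omega> = c)"
      "Measurable.pred M (\<lambda>\<omega>. Z Y \<omega> = c)" for s c
    using pred_takes[OF T] pred_takes[OF W] pred_takes[OF S] XY pred_eq_component by auto
  \<comment> \<open>\<open>q\<close> is an arbitrary function, but \<open>g\<close> factors through
    a vector that is measurable into a discrete space, hence is measurable.\<close>
  have "g = q \<circ> (\<lambda>\<omega>. \<lambda>i\<in>T \<union> W. Z i \<omega>)"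
    by (auto simp: g_def fun_eq_iff intro!: q(2))
  then have g[measurable]: "g \<in> borel_measurable M"
    using measurable_comp[OF measurable_restrict_family[OF S], of q borel] by simp
  have g_bound: "\<bar>g \<omega>\<bar> \<le> 1" for \<omega>
    by (simp add: g_def q(1))
  have int: "integrable M (\<lambda>\<omega>. g \<omega> * of_bool (P \<omega>))" if [measurable]: "Measurable.pred M P" for P
    by (rule integrable_const_bound[where B = 1])
      (auto simp: g_bound abs_mult intro!: mult_le_one AE_I2)
  have merge: "takes Z T t \<omega> \<and> takes Z W w \<omega> \<longleftrightarrow> takes Z (T \<union> W) (m t w) \<omega>" for t w \<omega>
    unfolding m_def using TW by (rule takes_merge)
  \<comment> \<open>Fixing all coordinates in \<open>T \<union> W\<close> makes \<open>g\<close>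
    constant, because \<open>q\<close> depends on no others.\<close>
  have const: "(\<integral>\<omega>. g \<omega> * of_bool (P \<omega> \<and> takes Z (T \<union> W) s \<omega>) \<partial>M) =
      q s * \<P>(\<omega> in M. P \<omega> \<and> takes Z (T \<union> W) s \<omega>)" if [measurable]: "Measurable.pred M P" for P s
  proof -
    have "(\<integral>\<omega>. g \<omega> * of_bool (P \<omega> \<and> takes Z (T \<union> W) s \<omega>) \<partial>M) =
        (\<integral>\<omega>. q s * of_bool (P \<omega> \<and> takes Z (T \<union> W) s \<omega>) \<partial>M)"
      by (rule Bochner_Integration.integral_cong) (auto simp: g_def takes_def intro!: q(2))
    then show ?thesis
      by (simp add: prob_eq_integral)
  qed
  have sum: "((\<lambda>w. q (m t w) * \<P>(\<omega> in M. P \<omega> \<and> takes Z (T \<union> W) (m t w) \<omega>))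
      has_sum (\<integral>\<omega>. g \<omega> * of_bool (P \<omega> \<and> takes Z T t \<omega>) \<partial>M)) (W \<rightarrow>\<^sub>E UNIV)"
    if [measurable]: "Measurable.pred M P" for P t
    unfolding const[OF that, symmetric] unfolding merge[symmetric]
    using has_sum_integral_takes[OF int[of "\<lambda>\<omega>. P \<omega> \<and> takes Z T t \<omega>"] W]
    by (simp add: of_bool_conj mult.assoc)
  have G_sum: "((\<lambda>w. q (m t w) * \<P>(\<omega> in M. Z X \<omega> = z \<and> takes Z (T \<union> W) (m t w) \<omega>))
      has_sum G z t) (W \<rightarrow>\<^sub>E UNIV)" for z t
    unfolding G_def by (rule sum) measurable
  \<comment> \<open>Summing \<open>y\<close> over the values of \<open>W\<close> gives the
    probability on one side and the series for \<open>G x t\<close> on the other.\<close>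
  have prob_y: "\<P>(\<omega> in M. Z Y \<omega> = y \<and> Z X \<omega> = x \<and> takes Z T t \<omega>) = G x t" for t
  proof (rule has_sum_unique[OF _ G_sum])
    show "((\<lambda>w. q (m t w) * \<P>(\<omega> in M. Z X \<omega> = x \<and> takes Z (T \<union> W) (m t w) \<omega>))
        has_sum \<P>(\<omega> in M. Z Y \<omega> = y \<and> Z X \<omega> = x \<and> takes Z T t \<omega>)) (W \<rightarrow>\<^sub>E UNIV)"
      unfolding y[symmetric] unfolding merge[symmetric]
      using has_sum_prob_takes[of "\<lambda>\<omega>. Z Y \<omega> = y \<and> Z X \<omega> = x \<and> takes Z T t \<omega>", OF _ W]
      by (simp add: conj_ac)
  qed
  \<comment> \<open>Cross-multiplied form of: the mean of \<open>g\<close> given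
    \<open>T = t\<close> is unchanged by conditioning further on \<open>X = z\<close>.\<close>
  have indep: "\<P>(\<omega> in M. takes Z T t \<omega>) * G z t =
      \<P>(\<omega> in M. Z X \<omega> = z \<and> takes Z T t \<omega>) * (\<integral>\<omega>. g \<omega> * of_bool (takes Z T t \<omega>) \<partial>M)" for z t
  proof -
    have prod: "\<P>(\<omega> in M. takes Z T t \<omega>) * \<P>(\<omega> in M. Z X \<omega> = z \<and> takes Z (T \<union> W) (m t w) \<omega>) =
      \<P>(\<omega> in M. Z X \<omega> = z \<and> takes Z T t \<omega>) * \<P>(\<omega> in M. takes Z (T \<union> W) (m t w) \<omega>)" for w
      using ci[unfolded cond_indep_iff_mult[OF T], rule_format, of "\<lambda>_. z" w t]
      unfolding merge[symmetric] by (simp add: takes_def[of Z "{X}"] conj_ac mult.commute)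
    have 1: "((\<lambda>w. q (m t w) * \<P>(\<omega> in M. takes Z (T \<union> W) (m t w) \<omega>))
        has_sum (\<integral>\<omega>. g \<omega> * of_bool (takes Z T t \<omega>) \<partial>M)) (W \<rightarrow>\<^sub>E UNIV)"
      using sum[of "\<lambda>_. True" t] by simp
    show ?thesis
    proof (rule has_sum_unique[OF has_sum_cmult_right[OF G_sum]])
      show "((\<lambda>w. \<P>(\<omega> in M. takes Z T t \<omega>) *
            (q (m t w) * \<P>(\<omega> in M. Z X \<omega> = z \<and> takes Z (T \<union> W) (m t w) \<omega>)))
          has_sum (\<P>(\<omega> in M. Z X \<omega> = z \<and> takes Z T t \<omega>) *
            (\<integral>\<omega>. g \<omega> * of_bool (takes Z T t \<omega>) \<partial>M))) (W \<rightarrow>\<^sub>E UNIV)"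
        using has_sum_cmult_right[OF 1, of "\<P>(\<omega> in M. Z X \<omega> = z \<and> takes Z T t \<omega>)"]
        by (simp only: mult.left_commute[of _ "q _"] prod)
    qed
  qed
  have stratum: "\<P>(\<omega> in M. Z Y \<omega> = y \<bar> Z X \<omega> = x \<and> takes Z T t \<omega>) *
      \<P>(\<omega> in M. Z X \<omega> = x' \<and> takes Z T t \<omega>) = G x' t" for t
  proof (cases "\<P>(\<omega> in M. Z X \<omega> = x' \<and> takes Z T t \<omega>) > 0")
    case True
    have "\<P>(\<omega> in M. Z X \<omega> = x' \<and> takes Z T t \<omega>) \<le> \<P>(\<omega> in M. takes Z T t \<omega>)"
      by (rule finite_measure_mono) auto
    with True have t: "\<P>(\<omega> in M. takes Z T t \<omega>) > 0"
      by linarith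
    \<comment> \<open>The mean of \<open>g\<close> given \<open>T = t\<close> is common to the
      strata of \<open>x\<close> and \<open>x'\<close>. By \<open>pos\<close>, the stratum of
      \<open>x\<close> has positive probability, so \<open>E\<close> equals the conditional
      probability of \<open>y\<close> there.\<close>
    define E where "E = (\<integral>\<omega>. g \<omega> * of_bool (takes Z T t \<omega>) \<partial>M) / \<P>(\<omega> in M. takes Z T t \<omega>)"
    have "G z t = \<P>(\<omega> in M. Z X \<omega> = z \<and> takes Z T t \<omega>) * E" for z
      using indep[of t z] t by (simp add: E_def field_simps)
    then show ?thesis
      using pos[OF True] by (simp add: cond_prob_def prob_y)
  next
    \<comment> \<open>On a null stratum of \<open>x'\<close> both sides are zero, whatever value the
      conditional probability of \<open>y\<close> has.\<close>
    case False
    then have 0: "\<P>(\<omega> in M. Z X \<omega> = x' \<and> takes Z T t \<omega>) = 0"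
      by (simp add: zero_less_measure_iff)
    then have "AE \<omega> in M. \<not> (Z X \<omega> = x' \<and> takes Z T t \<omega>)"
      by (subst (asm) prob_eq_0) auto
    then have "G x' t = 0"
      unfolding G_def by (intro integral_eq_zero_AE) auto
    with 0 show ?thesis
      by simp
  qed
  have "adjusted_prob M Z X Y x x' T y * \<P>(\<omega> in M. Z X \<omega> = x') =
      (\<integral>\<omega>. g \<omega> * of_bool (Z X \<omega> = x') \<partial>M)"
  proof (cases "T = {}")
    \<comment> \<open>With no covariates there is one stratum, the sure event, so
      \<open>stratum\<close> at any vector is already the claim.\<close>
    case True
    then show ?thesis
      using stratum[of undefined] by (simp add: adjusted_prob_def takes_def G_def)
  next
    case False
    let ?a = "\<lambda>t. \<P>(\<omega> in M. Z Y \<omega> = y \<bar> Z X \<omega> = x \<and> takes Z T t \<omega>) *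
      \<P>(\<omega> in M. takes Z T t \<omega> \<bar> Z X \<omega> = x')"
    have G: "G x' t = ?a t * \<P>(\<omega> in M. Z X \<omega> = x')" for t
      using x' by (simp add: stratum[symmetric] cond_prob_def conj_commute)
    have "((\<lambda>t. G x' t) has_sum (\<integral>\<omega>. g \<omega> * of_bool (Z X \<omega> = x') \<partial>M)) (T \<rightarrow>\<^sub>E UNIV)"
      using has_sum_integral_takes[OF int[of "\<lambda>\<omega>. Z X \<omega> = x'"] T]
      by (simp add: G_def of_bool_conj mult.assoc)
    then have "(?a has_sum ((\<integral>\<omega>. g \<omega> * of_bool (Z X \<omega> = x') \<partial>M) / \<P>(\<omega> in M. Z X \<omega> = x')))
        (T \<rightarrow>\<^sub>E UNIV)"
      using x' unfolding G by (subst (asm) has_sum_cmult_left_iff) auto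
    \<comment> \<open>The sum in \<open>adjusted_prob\<close> omits vectors of zero weight, whose
      terms vanish.\<close>
    also have "?this \<longleftrightarrow> (?a has_sum ((\<integral>\<omega>. g \<omega> * of_bool (Z X \<omega> = x') \<partial>M) / \<P>(\<omega> in M. Z X \<omega> = x')))
        {t \<in> T \<rightarrow>\<^sub>E UNIV. \<P>(\<omega> in M. takes Z T t \<omega> \<bar> Z X \<omega> = x') > 0}"
      by (rule has_sum_cong_neutral)
        (auto simp: cond_prob_def not_less divide_le_0_iff measure_le_0_iff)
    finally show ?thesis
      using x' False by (simp add: adjusted_prob_def infsumI)
  qed
  then show ?thesis
    using x' by (simp add: g_def field_simps)
qed

section \<open>Probability of the response given the blanket\<close>

text \<open>
  Setting the coordinate \<open>X\<close> of the conditioning vector to \<open>x\<close> covers both \<open>X \<in> U\<close> and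
  \<open>X \<notin> U\<close>.
\<close>

lemma markov_blanket_prob:
  assumes mb: "markov_blanket M Z Y V U" and V: "finite V" "V \<subseteq> I" and Y: "Y \<in> I"
    and S: "U - {X} \<subseteq> S" "S \<subseteq> V - {X}" and X: "X \<in> V"
  shows "\<P>(\<omega> in M. Z Y \<omega> = y \<and> Z X \<omega> = x \<and> takes Z S s \<omega>) =
    \<P>(\<omega> in M. Z Y \<omega> = y \<bar> takes Z U (s(X := x)) \<omega>) * \<P>(\<omega> in M. Z X \<omega> = x \<and> takes Z S s \<omega>)"
proof -
  \<comment> \<open>\<open>D\<close> collects the conditioning coordinates outside the blanket; it
    lies in \<open>V - U\<close>, so the decomposition property applies.\<close>
  define D where "D = insert X S - U"
  let ?s = "s(X := x)"
  have U: "finite U" "U \<subseteq> I" "U \<subseteq> V"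
    using mb V by (auto simp: markov_blanket_def intro: finite_subset)
  have ci: "cond_indep M Z {Y} D U"
    by (rule cond_indep_subset[where B = "V - U"])
      (use mb U V Y S X in \<open>auto simp: markov_blanket_def D_def\<close>)
  have prod: "\<P>(\<omega> in M. (Z Y \<omega> = y \<and> takes Z D ?s \<omega>) \<and> takes Z U ?s \<omega>) *
      \<P>(\<omega> in M. takes Z U ?s \<omega>) =
      \<P>(\<omega> in M. Z Y \<omega> = y \<and> takes Z U ?s \<omega>) * \<P>(\<omega> in M. takes Z D ?s \<omega> \<and> takes Z U ?s \<omega>)"
    using ci[unfolded cond_indep_iff_mult[OF U(1,2)], rule_format, of "\<lambda>_. y" ?s ?s]
    by (simp add: takes_def[of Z "{Y}"])
  have "D \<union> U = insert X S"
    using S by (auto simp: D_def)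
  \<comment> \<open>Overwriting the coordinate \<open>X\<close> does not disturb the values on
    \<open>S\<close>, as \<open>X\<close> is not in \<open>S\<close>.\<close>
  then have split: "Z X \<omega> = x \<and> takes Z S s \<omega> \<longleftrightarrow> takes Z D ?s \<omega> \<and> takes Z U ?s \<omega>" for \<omega>
    using S(2) by (subst takes_Un[symmetric]) (auto simp: takes_def)
  show ?thesis
  proof (cases "\<P>(\<omega> in M. takes Z U ?s \<omega>) = 0")
    \<comment> \<open>The conditional probability is then a division by zero, but both joint events
      refine a null event.\<close>
    case True
    have "\<P>(\<omega> in M. P \<omega> \<and> takes Z U ?s \<omega>) = 0" for P
    proof -
      have "\<P>(\<omega> in M. P \<omega> \<and> takes Z U ?s \<omega>) \<le> \<P>(\<omega> in M. takes Z U ?s \<omega>)"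
        using pred_takes[OF U(1,2)] by (intro finite_measure_mono) (auto simp: pred_def)
      then show ?thesis
        using True measure_nonneg[of M] by (simp add: antisym)
    qed
    from this[of "\<lambda>\<omega>. Z Y \<omega> = y \<and> takes Z D ?s \<omega>"] this[of "\<lambda>\<omega>. takes Z D ?s \<omega>"]
    show ?thesis
      unfolding split by simp
  next
    case False
    with prod show ?thesis
      unfolding split by (simp add: cond_prob_def field_simps)
  qed
qed

end

section \<open>Comparison of the two covariate sets\<close>

theorem theorem3:
  fixes M :: "'a measure"
    and Z :: "'i \<Rightarrow> 'a \<Rightarrow> 'v"
    and X Y :: 'i
    and x x' :: 'v
    and T\<^sub>1 T\<^sub>2 U :: "'i set"
  assumes "prob_space M"
    and "finite T\<^sub>1" and "finite T\<^sub>2"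
    and "X \<notin> T\<^sub>1 \<union> T\<^sub>2" and "Y \<notin> T\<^sub>1 \<union> T\<^sub>2"
    and "\<And>i. i \<in> {X, Y} \<union> T\<^sub>1 \<union> T\<^sub>2 \<Longrightarrow> discrete_rv M (Z i)"
    and "\<P>(\<omega> in M. Z X \<omega> = x) > 0"
    and "\<P>(\<omega> in M. Z X \<omega> = x') > 0"
    and "\<And>t. \<P>(\<omega> in M. Z X \<omega> = x' \<and> takes Z T\<^sub>1 t \<omega>) > 0 \<Longrightarrow>
              \<P>(\<omega> in M. Z X \<omega> = x \<and> takes Z T\<^sub>1 t \<omega>) > 0"
    and "\<And>t. \<P>(\<omega> in M. Z X \<omega> = x' \<and> takes Z T\<^sub>2 t \<omega>) > 0 \<Longrightarrow>
              \<P>(\<omega> in M. Z X \<omega> = x \<and> takes Z T\<^sub>2 t \<omega>) > 0"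
    and "markov_boundary M Z Y (T\<^sub>1 \<union> T\<^sub>2 \<union> {X}) U"
    and "cond_indep M Z {X} ((U - {X}) \<inter> (T\<^sub>2 - T\<^sub>1)) T\<^sub>1"
    and "cond_indep M Z {X} ((U - {X}) \<inter> (T\<^sub>1 - T\<^sub>2)) T\<^sub>2"
  shows "weakly_equivalent M Z X Y x x' T\<^sub>1 T\<^sub>2"
proof -
  interpret discrete_family M Z "{X, Y} \<union> T\<^sub>1 \<union> T\<^sub>2"
    using assms(1,6) by (simp add: discrete_family_def discrete_family_axioms_def)
  let ?V = "T\<^sub>1 \<union> T\<^sub>2 \<union> {X}"
  have mb: "markov_blanket M Z Y ?V U"
    using assms(11) by (simp add: markov_boundary_def)
  then have U: "U - {X} \<subseteq> T\<^sub>1 \<union> T\<^sub>2"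
    by (auto simp: markov_blanket_def)
  \<comment> \<open>Overwriting \<open>X\<close> by \<open>x\<close> keeps the treatment at
    \<open>x\<close> inside \<open>q\<close>, even when \<open>q\<close> is averaged over the event
    \<open>X = x'\<close>. The same \<open>q\<close> serves both covariate sets.\<close>
  define q where "q y s = \<P>(\<omega> in M. Z Y \<omega> = y \<bar> takes Z U (s(X := x)) \<omega>)" for y s
  have q_bound: "\<bar>q y s\<bar> \<le> 1" for y s
  proof -
    have "Measurable.pred M (takes Z U (s(X := x)))"
      using U assms(2,3) by (intro pred_takes) (auto intro: finite_subset[of _ ?V])
    then have "\<P>(\<omega> in M. Z Y \<omega> = y \<and> takes Z U (s(X := x)) \<omega>) \<le> \<P>(\<omega> in M. takes Z U (s(X := x)) \<omega>)"
      by (intro finite_measure_mono) (auto simp: pred_def)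
    then show ?thesis
      by (auto simp: q_def cond_prob_def divide_le_eq_1 zero_less_measure_iff)
  qed
  have q_cong: "q y s = q y t" if "\<And>i. i \<in> U - {X} \<Longrightarrow> s i = t i" for y s t
    using takes_cong[of U "s(X := x)" "t(X := x)" Z] that by (simp add: q_def)
  have q_prob: "\<P>(\<omega> in M. Z Y \<omega> = y \<and> Z X \<omega> = x \<and> takes Z S s \<omega>) =
      q y s * \<P>(\<omega> in M. Z X \<omega> = x \<and> takes Z S s \<omega>)"
    if "U - {X} \<subseteq> S" "S \<subseteq> T\<^sub>1 \<union> T\<^sub>2" for S y s
    unfolding q_def using that assms(2-4)
    by (intro markov_blanket_prob[OF mb]) auto
  \<comment> \<open>Stated for an ordered pair \<open>T\<close>, \<open>T'\<close> so that it
    applies in both orders, with the same right-hand side.\<close>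
  have "adjusted_prob M Z X Y x x' T y =
      (\<integral>\<omega>. q y (\<lambda>i. Z i \<omega>) * of_bool (Z X \<omega> = x') \<partial>M) / \<P>(\<omega> in M. Z X \<omega> = x')"
    if T: "T \<union> T' = T\<^sub>1 \<union> T\<^sub>2"
      and ci: "cond_indep M Z {X} ((U - {X}) \<inter> (T' - T)) T"
      and pos: "\<And>t. \<P>(\<omega> in M. Z X \<omega> = x' \<and> takes Z T t \<omega>) > 0 \<Longrightarrow>
        \<P>(\<omega> in M. Z X \<omega> = x \<and> takes Z T t \<omega>) > 0"
    for T T' y
  \<comment> \<open>This \<open>W\<close> is exactly what \<open>T\<close> lacks to contain
    \<open>U - {X}\<close>, and exactly the set in the independence assumption
    \<open>ci\<close>.\<close>
  proof (rule adjusted_prob_eq_expectation[where W = "(U - {X}) \<inter> (T' - T)", OF _ _ _ _ _ _ _ _ _ _ ci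
      assms(8) pos])
    have sub: "U - {X} \<subseteq> T \<union> (U - {X}) \<inter> (T' - T)"
      using U T by auto
    show "q y s = q y t" if "\<And>i. i \<in> T \<union> (U - {X}) \<inter> (T' - T) \<Longrightarrow> s i = t i" for s t
      using that sub by (intro q_cong) auto
    show "\<P>(\<omega> in M. Z Y \<omega> = y \<and> Z X \<omega> = x \<and> takes Z (T \<union> (U - {X}) \<inter> (T' - T)) s \<omega>) =
        q y s * \<P>(\<omega> in M. Z X \<omega> = x \<and> takes Z (T \<union> (U - {X}) \<inter> (T' - T)) s \<omega>)" for s
      using sub T by (intro q_prob) auto
    show "finite T" "finite ((U - {X}) \<inter> (T' - T))"
      using T assms(2,3) by (metis finite_Un finite_Diff finite_Int)+
  qed (use T q_bound in auto)
  from this[of T\<^sub>1 T\<^sub>2] this[of T\<^sub>2 T\<^sub>1] show ?thesis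
    unfolding weakly_equivalent_def using assms(9,10,12,13) by (simp add: Un_commute)
qed

end
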